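(* For all integers $k\ge 1$ and $1\le m\le k$, we have $w_{2k+1,k,m}=w_{2k+1,k,k+1-m}$.
   Context: A Dyck path of semilength $n$ is a word in the letters $U,D$ with $n$ copies of each letter such that no prefix contains more $D$'s than $U$'s. A $UD$-factor (resp. $UUD$-factor) is an occurrence of $UD$ (resp. $UUD$) as a consecutive subword. For nonnegative integers $n,k,m$, $w_{n,k,m}$ denotes the number of Dyck paths of semilength $n$ with exactly $k$ $UD$-factors and exactly $m$ $UUD$-factors. *)

theory Defs
  imports Main "HOL-Library.Sublist"
begin

datatype step = U | D

definition dyck_path :: "nat \<Rightarrow> step list \<Rightarrow> bool" where
  "dyck_path n p \<longleftrightarrow> count_list p U = n \<and> count_list p D = n \<and>
     (\<forall>q. prefix q p \<longrightarrow> count_list q D \<le> count_list q U)"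

text \<open>Occurrences of \<open>f\<close> as a consecutive subword are counted by their starting
  positions, so overlapping occurrences count separately.\<close>

definition factor_count :: "'a list \<Rightarrow> 'a list \<Rightarrow> nat" where
  "factor_count f p = card {i. i + length f \<le> length p \<and> take (length f) (drop i p) = f}"

definition dyck_number :: "nat \<Rightarrow> nat \<Rightarrow> nat \<Rightarrow> nat" where
  "dyck_number n k m =
     card {p. dyck_path n p \<and> factor_count [U, D] p = k \<and> factor_count [U, U, D] p = m}"

text \<open>The cardinality above is a genuine count, since the set is finite.\<close>

lemma finite_dyck_paths: "finite {p. dyck_path n p}"
proof (rule finite_subset)
  have "length p = count_list p U + count_list p D" for p
  proof (induction p)
    case (Cons a p)
    then show ?case by (cases a) auto
  qed simp
  then show "{p. dyck_path n p} \<subseteq> {p. set p \<subseteq> {U, D} \<and> length p = 2 * n}"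
    using step.exhaust by (auto simp: dyck_path_def)
  show "finite {p. set p \<subseteq> {U, D} \<and> length p = 2 * n}"
    by (rule finite_lists_length_eq) simp
qed

end

theory Submission
  imports Defs
begin

text \<open>Read a Dyck path with \<open>k\<close> peaks as \<open>k\<close> blocks \<open>U\<^sup>a\<^sup>+\<^sup>1D\<^sup>b\<^sup>+\<^sup>1\<close>; the \<open>UUD\<close>-factors are the
  blocks with \<open>a > 0\<close>. Lengthening the last run of down steps by one makes the total height
  \<open>-1\<close>, so by the cycle lemma exactly one of the \<open>k\<close> rotations of any block sequence of height
  \<open>-1\<close> comes from a Dyck path. Hence for semilength \<open>k + s\<close> the number of paths times \<open>k\<close> is
  \<open>(k choose m) * (s - 1 choose m - 1)\<close>, which counts the possible \<open>a\<close>-sequences, times a factor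
  independent of \<open>m\<close>. For \<open>s = k + 1\<close> this is symmetric under \<open>m \<mapsto> k + 1 - m\<close>.\<close>

section \<open>Prefix sums and the cycle lemma\<close>

text \<open>The start height is a parameter so that the predicate unfolds by recursion along the
  list.\<close>

definition nonneg_walk :: "int \<Rightarrow> int list \<Rightarrow> bool" where
  "nonneg_walk h zs \<longleftrightarrow> (\<forall>i\<le>length zs. 0 \<le> h + sum_list (take i zs))"

lemma nonneg_walk_Nil [simp]: "nonneg_walk h [] \<longleftrightarrow> 0 \<le> h"
  by (simp add: nonneg_walk_def)

lemma nonneg_walk_Cons [simp]: "nonneg_walk h (z # zs) \<longleftrightarrow> 0 \<le> h \<and> nonneg_walk (h + z) zs"
proof -
  have "(\<forall>i\<le>Suc (length zs). P i) \<longleftrightarrow> P 0 \<and> (\<forall>i\<le>length zs. P (Suc i))" for P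
    using less_Suc_eq_0_disj by (auto simp flip: less_Suc_eq_le)
  from this[of "\<lambda>i. 0 \<le> h + sum_list (take i (z # zs))"] show ?thesis
    by (simp add: nonneg_walk_def add.assoc)
qed

lemma nonneg_walk_start: "nonneg_walk h zs \<Longrightarrow> 0 \<le> h"
  by (cases zs) auto

lemma nonneg_walk_snoc:
  "nonneg_walk h (zs @ [z]) \<longleftrightarrow> nonneg_walk h zs \<and> 0 \<le> h + sum_list zs + z"
  by (induction zs arbitrary: h) (auto simp: add.assoc)

lemma nonneg_walk_sum: "nonneg_walk h zs \<Longrightarrow> 0 \<le> h + sum_list zs"
  by (force simp: nonneg_walk_def)

text \<open>Along a monotone run only the lower end matters: the start of an ascent here, the end of
  a descent in \<open>nonneg_walk_down\<close>.\<close>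

lemma nonneg_walk_up:
  "nonneg_walk h (replicate a 1 @ zs) \<longleftrightarrow> 0 \<le> h \<and> nonneg_walk (h + int a) zs"
proof (induction a arbitrary: h)
  case 0
  show ?case using nonneg_walk_start by auto
next
  case (Suc a)
  show ?case by (auto simp: Suc add.assoc)
qed

lemma nonneg_walk_down:
  "nonneg_walk h (replicate b (- 1) @ zs) \<longleftrightarrow> nonneg_walk (h - int b) zs"
proof (induction b arbitrary: h)
  case (Suc b)
  have eq: "h - 1 - int b = h - int (Suc b)" by simp
  have "nonneg_walk (h - int (Suc b)) zs \<Longrightarrow> 0 \<le> h"
    using nonneg_walk_start by force
  with Suc[of "h - 1", unfolded eq] show ?case by (auto simp del: of_nat_Suc)
qed simp

lemma nonneg_walk_butlast:
  assumes "zs \<noteq> []"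
  shows "nonneg_walk h (butlast zs) \<longleftrightarrow> (\<forall>i<length zs. 0 \<le> h + sum_list (take i zs))"
proof -
  have "i \<le> length zs - 1 \<longleftrightarrow> i < length zs" for i
    using assms by (cases zs) auto
  then show ?thesis
    by (auto simp: nonneg_walk_def take_butlast)
qed

text \<open>Starting at \<open>j\<close> shifts all prefix sums by that of \<open>j\<close>, and
  those that wrap around also pick up the total -1. Hence the inequality is weak from
  \<open>j\<close> onwards and strict before \<open>j\<close>.\<close>

lemma nonneg_walk_rotate:
  fixes zs :: "int list"
  assumes sum: "sum_list zs = - 1" and j: "j < length zs"
  shows "nonneg_walk 0 (butlast (rotate j zs)) \<longleftrightarrow>
    (\<forall>i<length zs. sum_list (take j zs) \<le> sum_list (take i zs) - (if i < j then 1 else 0))"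
    (is "?L \<longleftrightarrow> ?R")
proof -
  define S where "S i = sum_list (take i zs)" for i
  define n where "n = length zs"
  have ne: "rotate j zs \<noteq> []" using j by auto
  have rot: "rotate j zs = drop j zs @ take j zs"
    using j by (simp add: rotate_drop_take)
  have drop: "sum_list (take i (drop j zs)) = S (j + i) - S j" for i
    unfolding S_def take_add by simp
  have early: "sum_list (take i (rotate j zs)) = S (j + i) - S j" if "i \<le> n - j" for i
    using that by (simp add: rot drop n_def)
  have late: "sum_list (take i (rotate j zs)) = S (i - (n - j)) - 1 - S j"
    if "i \<ge> n - j" "i < n" for i
  proof -
    have "sum_list (drop j zs) = - 1 - S j"
      using sum_list_append[of "take j zs" "drop j zs"] by (simp add: S_def sum)
    moreover have "take (i - (n - j)) (take j zs) = take (i - (n - j)) zs"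
      using that by (simp add: min_def)
    ultimately show ?thesis using that
      by (simp add: rot n_def S_def)
  qed
  have "?L \<longleftrightarrow> (\<forall>i<n. 0 \<le> sum_list (take i (rotate j zs)))"
    using nonneg_walk_butlast[OF ne, of 0] by (simp add: n_def)
  also have "\<dots> \<longleftrightarrow> (\<forall>i<n. S j \<le> S i - (if i < j then 1 else 0))"
  proof (intro iffI allI impI)
    fix i assume *: "\<forall>i<n. 0 \<le> sum_list (take i (rotate j zs))" and i: "i < n"
    show "S j \<le> S i - (if i < j then 1 else 0)"
    proof (cases "i < j")
      case True
      \<comment> \<open>The rotated list first runs through the \<open>n - j\<close> entries from
        \<open>j\<close> on, so the original position \<open>i\<close> is reached
        \<open>n - j\<close> steps later.\<close>
      with j have "i + (n - j) < n" by (simp add: n_def)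
      with *[rule_format, of "i + (n - j)"] late[of "i + (n - j)"] True show ?thesis by simp
    next
      case False
      with i *[rule_format, of "i - j"] early[of "i - j"] show ?thesis by simp
    qed
  next
    fix i assume *: "\<forall>i<n. S j \<le> S i - (if i < j then 1 else 0)" and i: "i < n"
    show "0 \<le> sum_list (take i (rotate j zs))"
    proof (cases "i < n - j")
      case True
      with *[rule_format, of "j + i"] early[of i] show ?thesis by simp
    next
      case False
      with i have "i - (n - j) < j" "i - (n - j) < n" by auto
      with *[rule_format, of "i - (n - j)"] late[of i] i False show ?thesis by simp
    qed
  qed
  finally show ?thesis by (simp add: S_def n_def)
qed

text \<open>The good rotation starts right after the first minimum of the prefix sums.\<close>

lemma cycle_lemma:
  fixes zs :: "int list"
  assumes sum: "sum_list zs = - 1"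
  shows "\<exists>!j. j < length zs \<and> nonneg_walk 0 (butlast (rotate j zs))"
proof -
  define S where "S i = sum_list (take i zs)" for i
  define n where "n = length zs"
  define M where "M = Min (S ` {..<n})"
  have "zs \<noteq> []" using sum by auto
  then have "n > 0" by (simp add: n_def)
  then have ne: "S ` {..<n} \<noteq> {}" by auto
  have le: "M \<le> S i" if "i < n" for i
    using that by (simp add: M_def)
  have ex: "\<exists>j. j < n \<and> S j = M"
    using Min_in[OF _ ne] by (auto simp: M_def)
  define j where "j = (LEAST j. j < n \<and> S j = M)"
  have j: "j < n" "S j = M"
    using LeastI_ex[OF ex] by (simp_all add: j_def)
  \<comment> \<open>Choosing the least minimiser makes this strict; over the integers that is the
    gap of 1 demanded by \<open>good\<close>.\<close>
  have less: "M < S i" if "i < j" for i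
    using not_less_Least[OF that[unfolded j_def]] le[of i] that j(1) by force
  have good: "nonneg_walk 0 (butlast (rotate i zs)) \<longleftrightarrow>
      (\<forall>l<n. S i \<le> S l - (if l < i then 1 else 0))" if "i < n" for i
    using nonneg_walk_rotate[OF sum, of i] that by (simp add: S_def n_def)
  have j_good: "nonneg_walk 0 (butlast (rotate j zs))"
    unfolding good[OF j(1)] using j(2) le less by force
  \<comment> \<open>Of two distinct good positions, the later would need a strictly smaller prefix
    sum than the earlier, and the earlier one at most equal to that of the later.\<close>
  moreover have "i = j" if i: "i < n" "nonneg_walk 0 (butlast (rotate i zs))" for i
  proof (rule ccontr)
    assume "i \<noteq> j"
    with good[OF i(1)] good[OF j(1)] i j_good j(1)
    have "S i \<le> S j - (if j < i then 1 else 0)" "S j \<le> S i - (if i < j then 1 else 0)"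
      by blast+
    with \<open>i \<noteq> j\<close> show False by (auto split: if_splits)
  qed
  ultimately show ?thesis using j(1) unfolding n_def by blast
qed

text \<open>Double counting of the pairs \<open>(xs, j)\<close> whose \<open>j\<close>-th rotation
  is good: every \<open>xs\<close> has exactly one such \<open>j\<close>, and every \<open>j\<close>
  has equally many \<open>xs\<close> because rotation permutes \<open>T\<close>.\<close>

lemma card_cycle:
  fixes f :: "'a \<Rightarrow> int"
  assumes fin: "finite T"
    and len: "\<And>xs. xs \<in> T \<Longrightarrow> length xs = k"
    and sum: "\<And>xs. xs \<in> T \<Longrightarrow> sum_list (map f xs) = - 1"
    and rot: "\<And>xs. xs \<in> T \<Longrightarrow> rotate1 xs \<in> T"
  shows "card T = k * card {xs \<in> T. nonneg_walk 0 (butlast (map f xs))}"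
proof -
  let ?good = "\<lambda>xs. nonneg_walk 0 (butlast (map f xs))"
  have rotT: "rotate j xs \<in> T" if "xs \<in> T" for j xs
    using that by (induction j) (auto simp: rot)
  have inj: "inj_on (rotate j) T" for j
    by (rule inj_onI) (metis (no_types) inj_rotate1 inj_fn injD rotate_def)
  have bij: "bij_betw (rotate j) T T" for j
    using endo_inj_surj[OF fin _ inj] rotT inj by (simp add: bij_betw_def image_subset_iff)
  have "card T = (\<Sum>xs\<in>T. 1)" by simp
  also have "\<dots> = (\<Sum>xs\<in>T. card {j \<in> {..<k}. ?good (rotate j xs)})"
  proof (rule sum.cong)
    fix xs assume "xs \<in> T"
    from cycle_lemma[OF sum[OF this]] len[OF this]
    have "\<exists>!j. j \<in> {..<k} \<and> ?good (rotate j xs)" by (simp add: rotate_map)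
    then have "\<exists>j. {j \<in> {..<k}. ?good (rotate j xs)} = {j}" by blast
    then have "card {j \<in> {..<k}. ?good (rotate j xs)} = 1"
      unfolding One_nat_def card_1_singleton_iff .
    then show "1 = card {j \<in> {..<k}. ?good (rotate j xs)}" by (rule sym)
  qed simp
  also have "\<dots> = (\<Sum>j<k. card {xs \<in> T. ?good (rotate j xs)})"
    using sum.swap_restrict[OF fin finite_lessThan[of k],
        of "\<lambda>_ _. 1 :: nat" "\<lambda>xs j. ?good (rotate j xs)"]
    by simp
  also have "\<dots> = (\<Sum>j<k. card {xs \<in> T. ?good xs})"
  proof (rule sum.cong)
    fix j
    have "bij_betw (rotate j) {xs \<in> T. ?good (rotate j xs)} {xs \<in> T. ?good xs}"
    proof (rule bij_betw_imageI)
      show "rotate j ` {xs \<in> T. ?good (rotate j xs)} = {xs \<in> T. ?good xs}"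
      proof (intro equalityI subsetI)
        fix ys assume ys: "ys \<in> {xs \<in> T. ?good xs}"
        then obtain xs where "xs \<in> T" "ys = rotate j xs"
          using bij_betw_imp_surj_on[OF bij[of j]] by blast
        with ys show "ys \<in> rotate j ` {xs \<in> T. ?good (rotate j xs)}" by blast
      qed (use rotT in blast)
    qed (rule inj_on_subset[OF inj], blast)
    then show "card {xs \<in> T. ?good (rotate j xs)} = card {xs \<in> T. ?good xs}"
      by (rule bij_betw_same_card)
  qed simp
  finally show ?thesis by simp
qed

section \<open>Lists of natural numbers with given sum and support size\<close>

definition compositions :: "nat \<Rightarrow> nat \<Rightarrow> nat list set" where
  "compositions k s = {xs. length xs = k \<and> sum_list xs = s}"

definition support_size :: "nat list \<Rightarrow> nat" where
  "support_size xs = length (filter (\<lambda>x. 0 < x) xs)"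

lemma support_size_simps [simp]:
  "support_size [] = 0"
  "support_size (x # xs) = (if 0 < x then 1 else 0) + support_size xs"
  by (simp_all add: support_size_def)

lemma finite_compositions [simp]: "finite (compositions k s)"
proof (rule finite_subset)
  show "compositions k s \<subseteq> {xs. set xs \<subseteq> {..s} \<and> length xs = k}"
    using member_le_sum_list by (fastforce simp: compositions_def)
qed (simp add: finite_lists_length_eq)

text \<open>Split by the first entry: it is 0, or it is \<open>Suc s - t\<close>, which is positive,
  where \<open>t\<close> is the sum of the tail.\<close>

lemma card_compositions_support_Suc:
  "card {xs \<in> compositions (Suc k) (Suc s). support_size xs = Suc m} =
    card {xs \<in> compositions k (Suc s). support_size xs = Suc m} +
    (\<Sum>t\<le>s. card {xs \<in> compositions k t. support_size xs = m})"
proof -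
  let ?A = "\<lambda>k s m. {xs \<in> compositions k s. support_size xs = m}"
  let ?B = "\<lambda>t. (#) (Suc s - t) ` ?A k t m"
  have eq: "?A (Suc k) (Suc s) (Suc m) = (#) 0 ` ?A k (Suc s) (Suc m) \<union> (\<Union>t\<le>s. ?B t)"
  proof (intro equalityI subsetI)
    fix xs assume xs: "xs \<in> ?A (Suc k) (Suc s) (Suc m)"
    then obtain y ys where [simp]: "xs = y # ys"
      by (cases xs) (auto simp: compositions_def)
    show "xs \<in> (#) 0 ` ?A k (Suc s) (Suc m) \<union> (\<Union>t\<le>s. ?B t)"
    proof (cases "y = 0")
      case True
      with xs show ?thesis by (auto simp: compositions_def)
    next
      case False
      with xs have "xs \<in> ?B (sum_list ys)" "sum_list ys \<le> s"
        by (auto simp: compositions_def)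
      then show ?thesis by blast
    qed
  qed (auto simp: compositions_def)
  have "card (\<Union>t\<le>s. ?B t) = (\<Sum>t\<le>s. card (?B t))"
    by (rule card_UN_disjoint) auto
  moreover have "card (?B t) = card (?A k t m)" for t
    by (simp add: card_image)
  moreover have "(#) 0 ` ?A k (Suc s) (Suc m) \<inter> (\<Union>t\<le>s. ?B t) = {}"
    by auto
  ultimately show ?thesis
    unfolding eq by (subst card_Un_disjoint) (auto simp: card_image)
qed

lemma card_compositions_support_0:
  "card {xs \<in> compositions k s. support_size xs = 0} = (if s = 0 then 1 else 0)"
proof -
  have zero: "support_size xs = 0 \<longleftrightarrow> sum_list xs = 0" for xs
    by (induction xs) auto
  show ?thesis
  proof (cases "s = 0")
    case True
    have "{xs \<in> compositions k 0. support_size xs = 0} = {replicate k 0}"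
      by (auto simp: compositions_def zero replicate_eqI sum_list_replicate)
    with True show ?thesis by simp
  next
    case False
    then have "{xs \<in> compositions k s. support_size xs = 0} = {}"
      by (auto simp: compositions_def zero simp del: sum_list_eq_0_iff)
    with False show ?thesis by simp
  qed
qed

text \<open>One factor chooses the positions of the positive entries, the other counts the ways to
  write \<open>Suc s\<close> as an ordered sum of \<open>Suc m\<close> positive parts. The induction
  combines Pascal's rule with the hockey-stick identity.\<close>

lemma card_compositions_support:
  "card {xs \<in> compositions k (Suc s). support_size xs = Suc m} = (k choose Suc m) * (s choose m)"
proof (induction k arbitrary: s m)
  case 0
  show ?case by (auto simp: compositions_def)
next
  case (Suc k)
  have "(\<Sum>t\<le>s. card {xs \<in> compositions k t. support_size xs = m}) = (k choose m) * (s choose m)"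
  proof (cases m)
    case 0
    then show ?thesis by (simp add: card_compositions_support_0)
  next
    case [simp]: (Suc m')
    \<comment> \<open>The term for \<open>t = 0\<close> vanishes, so the sum can be shifted to
      positive totals, where the induction hypothesis applies.\<close>
    have "support_size xs \<noteq> Suc m'" if "sum_list xs = 0" for xs
      using that by (induction xs) auto
    then have [simp]: "{xs \<in> compositions k 0. support_size xs = Suc m'} = {}"
      by (auto simp: compositions_def)
    have "(\<Sum>t\<le>s. card {xs \<in> compositions k t. support_size xs = m}) =
        (\<Sum>t<s. card {xs \<in> compositions k (Suc t). support_size xs = Suc m'})"
      by (simp add: sum.atMost_shift)
    also have "\<dots> = (k choose m) * (\<Sum>t<s. t choose m')"
      by (simp add: Suc.IH sum_distrib_left)
    also have "(\<Sum>t<s. t choose m') = s choose m"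
      using sum_choose_upper[of m' "s - 1"]
      by (cases s) (simp_all add: lessThan_Suc_atMost atLeast0AtMost)
    finally show ?thesis .
  qed
  then show ?case
    by (simp only: card_compositions_support_Suc Suc.IH) (simp add: algebra_simps)
qed

section \<open>Block encoding of Dyck paths\<close>

text \<open>The pair \<open>(a, b)\<close> stands for \<open>a + 1\<close> up steps followed by \<open>b + 1\<close> down steps, so that
  all entries range over the natural numbers.\<close>

fun path_of_blocks :: "(nat \<times> nat) list \<Rightarrow> step list" where
  "path_of_blocks [] = []"
| "path_of_blocks ((a, b) # l) = replicate (Suc a) U @ replicate (Suc b) D @ path_of_blocks l"

text \<open>The first component counts the down steps that precede the first block.\<close>

fun parse :: "step list \<Rightarrow> nat \<times> (nat \<times> nat) list" where
  "parse [] = (0, [])"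
| "parse (D # p) = (case parse p of (b, l) \<Rightarrow> (Suc b, l))"
| "parse (U # p) = (case parse p of
      (Suc b, l) \<Rightarrow> (0, (0, b) # l)
    | (0, (a, b) # l) \<Rightarrow> (0, (Suc a, b) # l)
    | (0, []) \<Rightarrow> (0, []))"

lemma parse_down: "parse (replicate b D @ p) = (b + fst (parse p), snd (parse p))"
  by (induction b) (auto split: prod.split)

lemma parse_up:
  "parse p = (Suc b, l) \<Longrightarrow> parse (replicate (Suc a) U @ p) = (0, (a, b) # l)"
  by (induction a) auto

text \<open>\<open>parse\<close> serves as a left inverse: a path determines its blocks, so paths
  can be counted by block lists.\<close>

lemma parse_path_of_blocks: "parse (path_of_blocks l) = (0, l)"
proof (induction l rule: path_of_blocks.induct)
  case (2 a b l)
  have "parse (replicate (Suc b) D @ path_of_blocks l) = (Suc b, l)"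
    by (subst parse_down) (simp add: 2)
  then show ?case
    by (simp only: path_of_blocks.simps parse_up)
qed simp

lemma inj_path_of_blocks: "inj path_of_blocks"
  by (rule inj_on_inverseI[where g = "snd \<circ> parse"]) (simp add: parse_path_of_blocks)

text \<open>The leading run of down steps keeps the claim stable under passing to suffixes; ending
  in \<open>D\<close> ensures that every ascent is completed to a block.\<close>

lemma ex_blocks:
  "p = [] \<or> last p = D \<Longrightarrow> \<exists>b l. p = replicate b D @ path_of_blocks l"
proof (induction p)
  case Nil
  show ?case by (rule exI[of _ 0], rule exI[of _ "[]"]) simp
next
  case (Cons x p)
  then obtain b l where p: "p = replicate b D @ path_of_blocks l"
    by (auto split: if_splits)
  show ?case
  proof (cases x)
    case D
    with p have "x # p = replicate (Suc b) D @ path_of_blocks l" by simp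
    then show ?thesis by blast
  next
    case U
    with Cons.prems have "p \<noteq> []" by auto
    show ?thesis
    proof (cases b)
      case (Suc b')
      with p U have "x # p = replicate 0 D @ path_of_blocks ((0, b') # l)" by simp
      then show ?thesis by blast
    next
      \<comment> \<open>No down step precedes the first block, so the new \<open>U\<close> lengthens
        the ascent of that block.\<close>
      case 0
      with p \<open>p \<noteq> []\<close> obtain a c l' where "l = (a, c) # l'"
        by (cases l) auto
      with 0 p U have "x # p = replicate 0 D @ path_of_blocks ((Suc a, c) # l')" by simp
      then show ?thesis by blast
    qed
  qed
qed

section \<open>Factor counts of block paths\<close>

lemma factor_count_Cons:
  assumes "f \<noteq> []"
  shows "factor_count f (x # p) = (if prefix f (x # p) then 1 else 0) + factor_count f p"
proof -
  let ?P = "\<lambda>p i. i + length f \<le> length p \<and> take (length f) (drop i p) = f"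
  have "finite {i. ?P p i}"
    by (rule finite_subset[of _ "{..length p}"]) auto
  moreover have "{i. ?P (x # p) i} = (if ?P (x # p) 0 then {0} else {}) \<union> Suc ` {i. ?P p i}"
    (is "?A = ?B")
  proof (rule set_eqI)
    fix i show "i \<in> ?A \<longleftrightarrow> i \<in> ?B" by (cases i) auto
  qed
  moreover have "?P (x # p) 0 \<longleftrightarrow> prefix f (x # p)"
    by (metis add_0 append_eq_conv_conj drop0 prefix_def prefix_length_le)
  ultimately show ?thesis
    unfolding factor_count_def by (auto simp: card_image)
qed

lemma factor_count_Nil: "f \<noteq> [] \<Longrightarrow> factor_count f [] = 0"
  by (simp add: factor_count_def)

lemma factor_count_down:
  "factor_count (U # f) (replicate b D @ p) = factor_count (U # f) p"
  by (induction b) (auto simp: factor_count_Cons)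

lemma factor_count_UD_up:
  "factor_count [U, D] (replicate (Suc a) U @ D # p) = Suc (factor_count [U, D] p)"
  by (induction a) (auto simp: factor_count_Cons)

lemma factor_count_UUD_up:
  "factor_count [U, U, D] (replicate (Suc a) U @ D # p) =
    (if 0 < a then 1 else 0) + factor_count [U, U, D] p"
proof (induction a)
  case (Suc a)
  then show ?case by (cases a) (auto simp: factor_count_Cons)
qed (simp add: factor_count_Cons)

lemma factor_count_blocks:
  "factor_count [U, D] (path_of_blocks l) = length l"
  "factor_count [U, U, D] (path_of_blocks l) = support_size (map fst l)"
proof (induction l rule: path_of_blocks.induct)
  case 1
  { case 1 show ?case by (simp add: factor_count_Nil) }
  { case 2 show ?case by (simp add: factor_count_Nil) }
next
  case (2 a b l)
  { case 1 show ?case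
      using factor_count_UD_up[of a "replicate b D @ path_of_blocks l"] 2
      by (simp add: factor_count_down) }
  { case 2 show ?case
      using factor_count_UUD_up[of a "replicate b D @ path_of_blocks l"] "2.IH"
      by (simp add: factor_count_down) }
qed

lemma count_list_replicate:
  "count_list (replicate n x) y = (if x = y then n else 0)"
  by (induction n) auto

text \<open>The offset of one in each run separates off the number of blocks; this is why the
  semilength is later written as \<open>k + s\<close>.\<close>

lemma count_list_blocks:
  "count_list (path_of_blocks l) U = length l + sum_list (map fst l)"
  "count_list (path_of_blocks l) D = length l + sum_list (map snd l)"
  by (induction l rule: path_of_blocks.induct) (simp_all add: count_list_replicate)

section \<open>Heights of steps and blocks\<close>

definition step_height :: "step \<Rightarrow> int" where
  "step_height x = (case x of U \<Rightarrow> 1 | D \<Rightarrow> - 1)"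

lemma sum_step_height:
  "sum_list (map step_height p) = int (count_list p U) - int (count_list p D)"
  by (induction p) (auto simp: step_height_def split: step.splits)

lemma dyck_path_iff_nonneg_walk:
  "dyck_path n p \<longleftrightarrow> count_list p U = n \<and> count_list p D = n \<and>
    nonneg_walk 0 (map step_height p)"
proof -
  have "(\<forall>q. prefix q p \<longrightarrow> P q) \<longleftrightarrow> (\<forall>i\<le>length p. P (take i p))" for P
    by (metis append_eq_conv_conj prefix_def prefix_length_le take_is_prefix)
  then show ?thesis
    by (simp add: dyck_path_def nonneg_walk_def take_map sum_step_height)
qed

definition block_height :: "nat \<times> nat \<Rightarrow> int" where
  "block_height x = int (fst x) - int (snd x)"

lemma sum_block_height:
  "sum_list (map block_height l) = int (sum_list (map fst l)) - int (sum_list (map snd l))"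
  by (induction l) (auto simp: block_height_def)

text \<open>A block rises and then falls, so its lowest points are its two ends, and checking the
  heights between blocks suffices.\<close>

lemma nonneg_walk_blocks:
  "0 \<le> h \<Longrightarrow> nonneg_walk h (map step_height (path_of_blocks l)) \<longleftrightarrow>
    nonneg_walk h (map block_height l)"
proof (induction l arbitrary: h rule: path_of_blocks.induct)
  case (2 a b l)
  have "nonneg_walk h (map step_height (path_of_blocks ((a, b) # l))) \<longleftrightarrow>
      nonneg_walk (h + int a - int b) (map step_height (path_of_blocks l))"
    using 2(2) nonneg_walk_up[of h "Suc a"]
      nonneg_walk_down[of "h + int (Suc a)" "Suc b"]
    by (simp add: step_height_def algebra_simps del: replicate.simps)
  \<comment> \<open>The induction hypothesis covers a nonnegative new height; for a negative one
    both sides fail at the start.\<close>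
  also have "\<dots> \<longleftrightarrow> nonneg_walk (h + int a - int b) (map block_height l)"
    using 2(1) nonneg_walk_start by blast
  finally show ?case
    using 2(2) by (simp only: list.map nonneg_walk_Cons) (simp add: block_height_def add_diff_eq)
qed simp

lemma dyck_path_blocks:
  assumes "dyck_path n p"
  shows "\<exists>l. p = path_of_blocks l"
proof (cases "p = []")
  case True
  then show ?thesis by (auto intro: exI[of _ "[]"])
next
  case False
  note walk = assms[unfolded dyck_path_iff_nonneg_walk]
  have "last p = D"
  proof (rule ccontr)
    \<comment> \<open>A final up step would have to start at height -1, since the path ends at
      height 0.\<close>
    assume "last p \<noteq> D"
    then have "last p = U" by (cases "last p") auto
    with False obtain q where q: "p = q @ [U]" by (metis append_butlast_last_id)
    with walk have "nonneg_walk 0 (map step_height q)"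
      by (simp add: nonneg_walk_snoc)
    from nonneg_walk_sum[OF this] walk q show False
      by (simp add: sum_step_height)
  qed
  with ex_blocks obtain b l where p: "p = replicate b D @ path_of_blocks l" by blast
  \<comment> \<open>A leading down step would reach height -1 at once.\<close>
  have "b = 0"
  proof (cases b)
    case (Suc b')
    with walk p show ?thesis
      by (auto simp: step_height_def dest: nonneg_walk_start)
  qed
  with p show ?thesis by auto
qed

section \<open>Counting Dyck paths by block sequences\<close>

lemma dyck_number_blocks:
  "dyck_number (k + s) k m = card {l. length l = k \<and> sum_list (map fst l) = s \<and>
     sum_list (map snd l) = s \<and> support_size (map fst l) = m \<and> nonneg_walk 0 (map block_height l)}"
    (is "_ = card ?B")
proof -
  have "{p. dyck_path (k + s) p \<and> factor_count [U, D] p = k \<and> factor_count [U, U, D] p = m} =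
      path_of_blocks ` ?B"
    (is "?P = _")
  proof (intro equalityI subsetI)
    fix p assume p: "p \<in> ?P"
    then obtain l where l: "p = path_of_blocks l" using dyck_path_blocks by blast
    with p have "l \<in> ?B"
      by (auto simp: dyck_path_iff_nonneg_walk factor_count_blocks count_list_blocks
          nonneg_walk_blocks)
    with l show "p \<in> path_of_blocks ` ?B" by blast
  qed (auto simp: dyck_path_iff_nonneg_walk factor_count_blocks count_list_blocks
      nonneg_walk_blocks)
  then show ?thesis
    unfolding dyck_number_def by (simp add: card_image inj_on_subset[OF inj_path_of_blocks])
qed

text \<open>One extra final down step brings the total height to the -1 required by the cycle lemma.
  The end point is then exempt from the walk condition, hence \<open>butlast\<close>; nothing is
  lost, as the sums already fix the final height.\<close>

lemma card_open_last_block: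
  assumes "k \<ge> 1"
  shows "card {l. length l = k \<and> sum_list (map fst l) = s \<and>
      sum_list (map snd l) = s \<and> support_size (map fst l) = m \<and> nonneg_walk 0 (map block_height l)} =
    card {l. length l = k \<and> sum_list (map fst l) = s \<and>
      sum_list (map snd l) = Suc s \<and> support_size (map fst l) = m \<and>
      nonneg_walk 0 (butlast (map block_height l))}"
    (is "card ?B = card ?G")
proof (rule bij_betw_same_card)
  let ?inc = "\<lambda>l. butlast l @ [apsnd Suc (last l)]"
  \<comment> \<open>The subtraction truncates at 0, so \<open>pos\<close> below is needed to make
    this invert \<open>?inc\<close>.\<close>
  let ?dec = "\<lambda>l. butlast l @ [apsnd (\<lambda>b. b - 1) (last l)]"
  have snoc: "\<exists>l' a b. l = l' @ [(a, b)]" if "length l = k" for l :: "(nat \<times> nat) list"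
    using that assms by (cases l rule: rev_cases) auto
  \<comment> \<open>Before the last block the height is nonnegative, and afterwards it is \<open>-1\<close>.\<close>
  have pos: "0 < b" if "l' @ [(a, b)] \<in> ?G" for l' a b
    using that nonneg_walk_sum[of 0 "map block_height l'"]
    by (auto simp: sum_block_height)
  show "bij_betw ?inc ?B ?G"
  proof (rule bij_betw_byWitness[where f' = ?dec])
    show "\<forall>l\<in>?B. ?dec (?inc l) = l"
      using snoc by fastforce
    show "\<forall>l\<in>?G. ?inc (?dec l) = l"
    proof
      fix l assume l: "l \<in> ?G"
      then obtain l' a b where "l = l' @ [(a, b)]" using snoc by blast
      with pos l show "?inc (?dec l) = l" by simp
    qed
    show "?inc ` ?B \<subseteq> ?G"
    proof (rule image_subsetI)
      fix l assume l: "l \<in> ?B"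
      then obtain l' a b where "l = l' @ [(a, b)]" using snoc by blast
      with l show "?inc l \<in> ?G"
        by (auto simp: nonneg_walk_snoc support_size_def)
    qed
    show "?dec ` ?G \<subseteq> ?B"
    proof (rule image_subsetI)
      fix l assume l: "l \<in> ?G"
      then obtain l' a b where [simp]: "l = l' @ [(a, b)]" using snoc by blast
      from pos[of l' a b] l obtain b' where [simp]: "b = Suc b'" by (cases b) auto
      from l show "?dec l \<in> ?B"
        by (auto simp: nonneg_walk_snoc support_size_def sum_block_height block_height_def)
    qed
  qed
qed

text \<open>Without the walk condition, ascents and descents are chosen independently.\<close>

lemma card_pairs_of_lists:
  "card {l. length l = k \<and> map fst l \<in> A \<and> map snd l \<in> B} =
    card {xs \<in> A. length xs = k} * card {ys \<in> B. length ys = k}"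
proof -
  have "bij_betw (\<lambda>l. (map fst l, map snd l)) {l. length l = k \<and> map fst l \<in> A \<and> map snd l \<in> B}
      ({xs \<in> A. length xs = k} \<times> {ys \<in> B. length ys = k})"
    by (rule bij_betw_byWitness[where f' = "\<lambda>(xs, ys). zip xs ys"])
      (auto simp: zip_map_fst_snd)
  from bij_betw_same_card[OF this] show ?thesis
    by (simp add: card_cartesian_product)
qed

text \<open>The cycle lemma is applied to all block sequences with the given sums and support, a
  family closed under rotation. Only the factor for the ascents depends on \<open>m\<close>.\<close>

lemma dyck_number_cycle:
  assumes "k \<ge> 1"
  shows "k * dyck_number (k + s) k m =
    card {xs \<in> compositions k s. support_size xs = m} * card (compositions k (Suc s))"
proof -
  let ?T = "{l. length l = k \<and> map fst l \<in> {xs \<in> compositions k s. support_size xs = m} \<and>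
    map snd l \<in> compositions k (Suc s)}"
  have card_T: "card ?T =
      card {xs \<in> compositions k s. support_size xs = m} * card (compositions k (Suc s))"
    unfolding card_pairs_of_lists
    by (rule arg_cong2[where f = "\<lambda>A B. card A * card B"]) (auto simp: compositions_def)
  have fin: "finite ?T"
  proof (rule finite_imageD)
    show "inj_on (\<lambda>l. (map fst l, map snd l)) ?T"
      by (rule inj_onI) (metis prod.inject zip_map_fst_snd)
    show "finite ((\<lambda>l. (map fst l, map snd l)) ` ?T)"
      by (rule finite_subset[of _ "compositions k s \<times> compositions k (Suc s)"]) auto
  qed
  have "card ?T = k * card {l \<in> ?T. nonneg_walk 0 (butlast (map block_height l))}"
  proof (rule card_cycle[OF fin])
    show "rotate1 l \<in> ?T" if "l \<in> ?T" for l
      using that by (cases l) (auto simp: compositions_def support_size_def)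
  qed (auto simp: compositions_def sum_block_height)
  also have "{l \<in> ?T. nonneg_walk 0 (butlast (map block_height l))} =
    {l. length l = k \<and> sum_list (map fst l) = s \<and>
      sum_list (map snd l) = Suc s \<and> support_size (map fst l) = m \<and>
      nonneg_walk 0 (butlast (map block_height l))}"
    by (auto simp: compositions_def)
  finally show ?thesis
    by (simp only: dyck_number_blocks card_open_last_block[OF assms] card_T)
qed

theorem theorem1p1:
  fixes k m :: nat
  assumes "k \<ge> 1" and "1 \<le> m" and "m \<le> k"
  shows "dyck_number (2 * k + 1) k m = dyck_number (2 * k + 1) k (k + 1 - m)"
proof -
  \<comment> \<open>Here \<open>s = k + 1\<close>, so the binomial with upper index
    \<open>s - 1\<close> also has upper index \<open>k\<close>.\<close>
  have count: "k * dyck_number (2 * k + 1) k (Suc j) =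
      (k choose Suc j) * (k choose j) * card (compositions k (Suc (Suc k)))" for j
    using dyck_number_cycle[OF assms(1), of "Suc k" "Suc j"]
    by (simp add: card_compositions_support mult_2)
  obtain j where j: "m = Suc j" using assms(2) by (cases m) auto
  \<comment> \<open>Replacing \<open>m\<close> by \<open>k + 1 - m\<close> swaps the two binomials,
    by the symmetry of row \<open>k\<close>.\<close>
  with assms(3) have "k + 1 - m = Suc (k - m)"
    and "k choose Suc (k - m) = k choose j" and "k choose (k - m) = k choose Suc j"
    using binomial_symmetric[of j k] binomial_symmetric[of m k] by (auto simp: Suc_diff_Suc)
  then have "k * dyck_number (2 * k + 1) k m = k * dyck_number (2 * k + 1) k (k + 1 - m)"
    using count[of j] count[of "k - m"] j by (simp add: mult.commute)
  with assms(1) show ?thesis by simp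
qed

end
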